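(* Let $(u_n^k)$ be real numbers satisfying the finite-difference scheme $$ \frac{\delta_t^2u_n^k}{(\Delta t)^2}-\left(c^2+\frac{\beta}{2\Delta t}\delta_t\right)\delta_x^2u_n^k+\frac{\alpha}{2\Delta t}\delta_tu_n^k+\frac{m^2}{2}\left[u_n^{k+1}+u_n^{k-1}\right]+\frac{V(u_n^{k+1})-V(u_n^{k-1})}{u_n^{k+1}-u_n^{k-1}}=0 $$ for $1\le n\le N$ and $1\le k\le M-1$, subject to $u_n^0=\phi(n)$ and $u_n^1=\phi(n)+\Delta t\,\varphi(n)$ for $1\le n\le N$, $u_0^k=\psi(k\Delta t)$, and with $u_n^k=0$ for all $n\ge N+1$. Then for every positive index $k\le M-1$, $$ \frac{E_k-E_{k-1}}{\Delta t}=c^2(u_0^k-u_1^k)\frac{\delta_tu_0^k}{2\Delta t}-\gamma\sum_{n=1}^{\infty}\left(\frac{\delta_tu_n^k}{2\Delta t}\right)^2-\beta\left[\sum_{n=1}^\infty\left(\frac{\delta_tu_n^k-\delta_tu_{n-1}^k}{2\Delta t}\right)^2+\left(\frac{\delta_tu_1^k-\delta_tu_0^k}{2\Delta t}\right)\frac{\delta_tu_0^k}{2\Delta t}\right]. $$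
   Context: $N$ is the number of oscillators; $0=t_0<t_1<\dots<t_M=T$ is a regular partition of $[0,T]$ with time step $\Delta t>0$; $u_n^k$ ($0\le k\le M$, $n\ge 0$) is the approximation on the $n$-th oscillator at time $t_k$. Notation: $\delta_tu_n^k=u_n^{k+1}-u_n^{k-1}$, $\delta_t^2u_n^k=u_n^{k+1}-2u_n^k+u_n^{k-1}$, $\delta_x^2u_n^k=u_{n+1}^k-2u_n^k+u_{n-1}^k$. The constant $\beta\ge 0$ is the internal damping coefficient, the constant $\gamma\ge 0$ is the external damping coefficient, $c$ is the coupling coefficient, and $m^2$ is a real constant. The coefficient $\alpha$ in the scheme (which may depend on $n$) includes both the effect of external damping and a simulation of an absorbing boundary on the last $N-N_0$ oscillators: on the $n$-th oscillator, $\alpha=\gamma+\gamma'(n)$, with $\gamma'(n)=\kappa\left[1+\tanh\left(\frac{2n-N_0+N}{2\sigma}\right)\right]$ for $N_0<n\le N$ and $\gamma'(n)=0$ otherwise, where $\kappa,\sigma>0$ and $N_0<N$ are constants (in practice $\kappa=0.5$, $\sigma=3$, $N_0=150$, $N=200$). The potential is $V(u)=1-\cos u$ (sine-Gordon chain), or $V(u)=\frac{1}{2!}u^2-\frac{1}{4!}u^4+\frac{1}{6!}u^6$ with $m=0$ (Klein-Gordon chain). The functions $\phi,\varphi$ are the initial data and $\psi$ is the boundary-driving function. The quotient $\frac{V(u_n^{k+1})-V(u_n^{k-1})}{u_n^{k+1}-u_n^{k-1}}$ is understood as $V'(u_n^{k-1})$ when $u_n^{k+1}=u_n^{k-1}$.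 The discrete total energy at the $k$-th time step is $$ \begin{aligned} E_k={}&\frac12\sum_{n=1}^{N}\left(\frac{u_n^{k+1}-u_n^k}{\Delta t}\right)^2+\frac{c^2}{2}\sum_{n=1}^{N}(u_{n+1}^{k+1}-u_n^{k+1})(u_{n+1}^k-u_n^k)+\frac{m^2}{2}\sum_{n=1}^{N}\frac{(u_n^{k+1})^2+(u_n^k)^2}{2}\\ &+\sum_{n=1}^{N}\frac{V(u_n^{k+1})+V(u_n^k)}{2}+\frac{c^2}{2}(u_1^{k+1}-u_0^{k+1})(u_1^k-u_0^k). \end{aligned} $$
   Formalization: The external dissipation term −γΣ(δ_t u_n^k/2Δt)² is corrected to −Σα(n)(δ_t u_n^k/2Δt)², with α(n)=γ+γ'(n) as in the scheme; the printed formula fails once the absorbing layer moves. κ=0 is also allowed, giving the printed formula. *)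

theory Defs
  imports "HOL-Analysis.Analysis"
begin

text \<open>Grid functions are written \<open>u n k\<close>: oscillator \<open>n\<close> first, time step \<open>k\<close> second. Indices are natural
  numbers, so the centred operators are meaningful only for \<open>k \<ge> 1\<close> (in time) and \<open>n \<ge> 1\<close> (in space).\<close>

type_synonym grid = "nat \<Rightarrow> nat \<Rightarrow> real"

definition delta_t :: "grid \<Rightarrow> grid" where
  "delta_t u n k = u n (k + 1) - u n (k - 1)"

definition delta_t2 :: "grid \<Rightarrow> grid" where
  "delta_t2 u n k = u n (k + 1) - 2 * u n k + u n (k - 1)"

definition delta_x2 :: "grid \<Rightarrow> grid" where
  "delta_x2 u n k = u (n + 1) k - 2 * u n k + u (n - 1) k"

definition sine_gordon_potential :: "real \<Rightarrow> real" where
  "sine_gordon_potential x = 1 - cos x"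

definition klein_gordon_potential :: "real \<Rightarrow> real" where
  "klein_gordon_potential x = x ^ 2 / fact 2 - x ^ 4 / fact 4 + x ^ 6 / fact 6"

definition diff_quotient :: "(real \<Rightarrow> real) \<Rightarrow> real \<Rightarrow> real \<Rightarrow> real" where
  "diff_quotient V x y = (if x = y then deriv V y else (V x - V y) / (x - y))"

definition absorbing_damping :: "real \<Rightarrow> real \<Rightarrow> nat \<Rightarrow> nat \<Rightarrow> nat \<Rightarrow> real" where
  "absorbing_damping \<kappa> \<sigma> N\<^sub>0 N n =
     (if N\<^sub>0 < n \<and> n \<le> N
      then \<kappa> * (1 + tanh ((2 * real n - real N\<^sub>0 + real N) / (2 * \<sigma>))) else 0)"

text \<open>This $n$-dependent coefficient, not the constant \<open>\<gamma>\<close> alone, weights the external dissipation in the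
  energy balance of the scheme: the absorbing layer removes energy as well. The two balances agree
  if \<open>\<kappa> = 0\<close>.\<close>

definition total_damping :: "real \<Rightarrow> real \<Rightarrow> real \<Rightarrow> nat \<Rightarrow> nat \<Rightarrow> nat \<Rightarrow> real" where
  "total_damping \<gamma> \<kappa> \<sigma> N\<^sub>0 N n = \<gamma> + absorbing_damping \<kappa> \<sigma> N\<^sub>0 N n"

text \<open>The parameter \<open>m2\<close> below is the real constant usually written $m^2$; it is not assumed
  to be the square of a real number.\<close>

definition scheme_lhs ::
  "real \<Rightarrow> real \<Rightarrow> real \<Rightarrow> (nat \<Rightarrow> real) \<Rightarrow> real \<Rightarrow> (real \<Rightarrow> real) \<Rightarrow> grid \<Rightarrow> grid" where
  "scheme_lhs \<Delta>t c \<beta> \<alpha> m2 V u n k =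
     delta_t2 u n k / \<Delta>t ^ 2
     - (c ^ 2 * delta_x2 u n k + \<beta> / (2 * \<Delta>t) * delta_t (delta_x2 u) n k)
     + \<alpha> n / (2 * \<Delta>t) * delta_t u n k
     + m2 / 2 * (u n (k + 1) + u n (k - 1))
     + diff_quotient V (u n (k + 1)) (u n (k - 1))"

definition energy ::
  "nat \<Rightarrow> real \<Rightarrow> real \<Rightarrow> real \<Rightarrow> (real \<Rightarrow> real) \<Rightarrow> grid \<Rightarrow> nat \<Rightarrow> real" where
  "energy N \<Delta>t c m2 V u k =
     1 / 2 * (\<Sum>n=1..N. ((u n (k + 1) - u n k) / \<Delta>t) ^ 2)
     + c ^ 2 / 2 * (\<Sum>n=1..N. (u (n + 1) (k + 1) - u n (k + 1)) * (u (n + 1) k - u n k))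
     + m2 / 2 * (\<Sum>n=1..N. (u n (k + 1) ^ 2 + u n k ^ 2) / 2)
     + (\<Sum>n=1..N. (V (u n (k + 1)) + V (u n k)) / 2)
     + c ^ 2 / 2 * (u 1 (k + 1) - u 0 (k + 1)) * (u 1 k - u 0 k)"

end

theory Submission
  imports Defs
begin

text \<open>The scheme is the equation of motion of a chain whose time derivatives are replaced by centred
  differences, so the classical energy argument survives discretisation: multiply the equation by
  the displacement \<open>w n = delta_t u n k\<close> over two time steps, which stands for the velocity, and
  sum over \<open>n\<close>. In time, half the products of \<open>w n\<close> with the inertial, linear and potential terms
  are exact differences of the corresponding parts of the energy (lemma \<open>energy_difference\<close>). For
  the potential this works because the scheme uses the difference quotient of \<open>V\<close> between the
  outer levels and not \<open>V'\<close>. The coupling energy is a product of strains at consecutive levels, so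
  that its change is the strain at level \<open>k\<close> times the strain of \<open>w\<close>.

  In space, summation by parts (lemma \<open>summation_by_parts\<close>) moves one difference from the
  discrete Laplacian to \<open>w\<close>. Applied to the Laplacian of \<open>u\<close> at level \<open>k\<close> it cancels the change of
  the coupling energy and leaves the work done at the driven end \<open>n = 0\<close>; applied to the Laplacian
  of \<open>w\<close> it gives the internal dissipation, minus a sum of squares, together with its own boundary
  term. At the other end nothing remains, since \<open>w\<close> vanishes there. The external damping is
  diagonal and contributes its weighted squares directly. The chain is at rest beyond the last
  oscillator, so the infinite sums are finite ones.\<close>

text \<open>With this identity the quotient may be treated as a genuine quotient throughout: both sides
  vanish at coincident arguments, whatever value the quotient has there.\<close>

lemma diff_quotient_mult: "(x - y) * diff_quotient V x y = V x - V y"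
  by (simp add: diff_quotient_def)

text \<open>Discrete Green's formula for the Laplacian on the vertices \<open>1, \<dots>, N\<close>. The edge from \<open>0\<close> to \<open>1\<close>
  is kept in the boundary term, which matches the way the energy singles out that edge.\<close>

lemma summation_by_parts:
  fixes w q :: "nat \<Rightarrow> 'a::comm_ring_1"
  shows "(\<Sum>n=1..N. w n * (q (n + 1) - 2 * q n + q (n - 1))) =
     w (N + 1) * (q (N + 1) - q N) - w 1 * (q 1 - q 0)
     - (\<Sum>n=1..N. (w (n + 1) - w n) * (q (n + 1) - q n))"
  by (induction N) (simp_all add: algebra_simps)

text \<open>The kinetic and linear parts change by differences of squares, \<open>(a - b) * (a + b)\<close>, in which one
  of the two factors is the displacement from level \<open>k - 1\<close> to level \<open>k + 1\<close>. This puts a factor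
  \<open>delta_t u n k\<close> in front of exactly those terms of the scheme that are conservative and local. The
  coupling is left as a product of strains, the form that summation by parts can absorb.\<close>

lemma energy_difference:
  assumes "1 \<le> k"
  shows "energy N \<Delta>t c m2 V u k - energy N \<Delta>t c m2 V u (k - 1) =
     (\<Sum>n=1..N. delta_t u n k / 2 *
        (delta_t2 u n k / \<Delta>t ^ 2 + m2 / 2 * (u n (k + 1) + u n (k - 1))
         + diff_quotient V (u n (k + 1)) (u n (k - 1))))
     + c ^ 2 / 2 *
        ((\<Sum>n=1..N. (delta_t u (n + 1) k - delta_t u n k) * (u (n + 1) k - u n k))
         + (delta_t u 1 k - delta_t u 0 k) * (u 1 k - u 0 k))"
proof -
  have k: "k - 1 + 1 = k"
    using assms by simp
  have kinetic: "1 / 2 * (\<Sum>n=1..N. ((u n (k + 1) - u n k) / \<Delta>t) ^ 2)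
      - 1 / 2 * (\<Sum>n=1..N. ((u n k - u n (k - 1)) / \<Delta>t) ^ 2)
      = (\<Sum>n=1..N. delta_t u n k / 2 * (delta_t2 u n k / \<Delta>t ^ 2))"
    unfolding sum_distrib_left sum_subtractf [symmetric] delta_t_def delta_t2_def
    by (intro sum.cong refl)
      (simp add: power_divide diff_divide_distrib [symmetric] power2_eq_square, simp add: algebra_simps)
  have coupling: "(\<Sum>n=1..N. (u (n + 1) (k + 1) - u n (k + 1)) * (u (n + 1) k - u n k))
      - (\<Sum>n=1..N. (u (n + 1) k - u n k) * (u (n + 1) (k - 1) - u n (k - 1)))
      = (\<Sum>n=1..N. (delta_t u (n + 1) k - delta_t u n k) * (u (n + 1) k - u n k))"
    unfolding sum_subtractf [symmetric] delta_t_def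
    by (intro sum.cong refl) (simp add: algebra_simps)
  have linear: "m2 / 2 * (\<Sum>n=1..N. (u n (k + 1) ^ 2 + u n k ^ 2) / 2)
      - m2 / 2 * (\<Sum>n=1..N. (u n k ^ 2 + u n (k - 1) ^ 2) / 2)
      = (\<Sum>n=1..N. delta_t u n k / 2 * (m2 / 2 * (u n (k + 1) + u n (k - 1))))"
    unfolding sum_distrib_left sum_subtractf [symmetric] delta_t_def
    by (intro sum.cong refl) (simp add: field_simps power2_eq_square)
  have potential: "(\<Sum>n=1..N. (V (u n (k + 1)) + V (u n k)) / 2)
      - (\<Sum>n=1..N. (V (u n k) + V (u n (k - 1))) / 2)
      = (\<Sum>n=1..N. delta_t u n k / 2 * diff_quotient V (u n (k + 1)) (u n (k - 1)))"
    unfolding sum_subtractf [symmetric] delta_t_def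
    by (intro sum.cong refl)
      (simp only: times_divide_eq_left diff_quotient_mult, simp add: field_simps)
  have end_edge: "(u 1 (k + 1) - u 0 (k + 1)) * (u 1 k - u 0 k)
      - (u 1 k - u 0 k) * (u 1 (k - 1) - u 0 (k - 1))
      = (delta_t u 1 k - delta_t u 0 k) * (u 1 k - u 0 k)"
    by (simp add: delta_t_def algebra_simps)
  have split: "(\<Sum>n=1..N. delta_t u n k / 2 *
        (delta_t2 u n k / \<Delta>t ^ 2 + m2 / 2 * (u n (k + 1) + u n (k - 1))
         + diff_quotient V (u n (k + 1)) (u n (k - 1))))
      = (\<Sum>n=1..N. delta_t u n k / 2 * (delta_t2 u n k / \<Delta>t ^ 2))
        + (\<Sum>n=1..N. delta_t u n k / 2 * (m2 / 2 * (u n (k + 1) + u n (k - 1))))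
        + (\<Sum>n=1..N. delta_t u n k / 2 * diff_quotient V (u n (k + 1)) (u n (k - 1)))"
    unfolding sum.distrib [symmetric] by (intro sum.cong refl) (simp only: distrib_left)
  show ?thesis
    unfolding split energy_def k kinetic [symmetric] coupling [symmetric] linear [symmetric]
      potential [symmetric] end_edge [symmetric]
    by (simp add: field_simps)
qed

text \<open>The energy balance is an algebraic identity at each time step. The displacement over two steps
  has to vanish just beyond the last oscillator, as otherwise work would be done on that end too.
  The edges carrying the internal dissipation are indexed by their right ends, which is why that
  sum runs to \<open>N + 1\<close>.\<close>

lemma energy_balance_finite:
  assumes "\<Delta>t \<noteq> 0" "1 \<le> k"
    and scheme: "\<And>n. 1 \<le> n \<Longrightarrow> n \<le> N \<Longrightarrow> scheme_lhs \<Delta>t c \<beta> \<alpha> m2 V u n k = 0"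
    and rest: "delta_t u (N + 1) k = 0"
  shows "(energy N \<Delta>t c m2 V u k - energy N \<Delta>t c m2 V u (k - 1)) / \<Delta>t =
           c ^ 2 * (u 0 k - u 1 k) * (delta_t u 0 k / (2 * \<Delta>t))
           - (\<Sum>n=1..N. \<alpha> n * (delta_t u n k / (2 * \<Delta>t)) ^ 2)
           - \<beta> * ((\<Sum>n=1..N + 1. ((delta_t u n k - delta_t u (n - 1) k) / (2 * \<Delta>t)) ^ 2)
                  + (delta_t u 1 k - delta_t u 0 k) / (2 * \<Delta>t) * (delta_t u 0 k / (2 * \<Delta>t)))"
proof -
  define w where "w n = delta_t u n k" for n
  define q where "q n = u n k" for n
  define S where "S = (\<Sum>n=1..N. (w (n + 1) - w n) * (q (n + 1) - q n))"
  define D where "D = (\<Sum>n=1..N. (w (n + 1) - w n) ^ 2)"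
  define A where "A = (\<Sum>n=1..N. \<alpha> n * w n ^ 2)"

  have Laplacian_w: "delta_t (delta_x2 u) n k = w (n + 1) - 2 * w n + w (n - 1)" for n
    by (simp add: w_def delta_t_def delta_x2_def)
  have "w n / 2 * (delta_t2 u n k / \<Delta>t ^ 2 + m2 / 2 * (u n (k + 1) + u n (k - 1))
          + diff_quotient V (u n (k + 1)) (u n (k - 1)))
      = c ^ 2 / 2 * (w n * (q (n + 1) - 2 * q n + q (n - 1)))
        + \<beta> / (4 * \<Delta>t) * (w n * (w (n + 1) - 2 * w n + w (n - 1)))
        - 1 / (4 * \<Delta>t) * (\<alpha> n * w n ^ 2)" if "n \<in> {1..N}" for n
  proof -
    have solved: "delta_t2 u n k / \<Delta>t ^ 2 + m2 / 2 * (u n (k + 1) + u n (k - 1))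
          + diff_quotient V (u n (k + 1)) (u n (k - 1))
        = c ^ 2 * (q (n + 1) - 2 * q n + q (n - 1))
          + \<beta> / (2 * \<Delta>t) * (w (n + 1) - 2 * w n + w (n - 1)) - \<alpha> n / (2 * \<Delta>t) * w n"
      using scheme [of n] that
      unfolding scheme_lhs_def Laplacian_w
      by (simp add: w_def [symmetric] q_def delta_x2_def)
    show ?thesis
      unfolding solved using \<open>\<Delta>t \<noteq> 0\<close> by (simp add: field_simps power2_eq_square)
  qed
  then have "(\<Sum>n=1..N. w n / 2 * (delta_t2 u n k / \<Delta>t ^ 2 + m2 / 2 * (u n (k + 1) + u n (k - 1))
          + diff_quotient V (u n (k + 1)) (u n (k - 1))))
      = c ^ 2 / 2 * (\<Sum>n=1..N. w n * (q (n + 1) - 2 * q n + q (n - 1)))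
        + \<beta> / (4 * \<Delta>t) * (\<Sum>n=1..N. w n * (w (n + 1) - 2 * w n + w (n - 1)))
        - 1 / (4 * \<Delta>t) * A"
    by (simp only: sum.distrib sum_subtractf sum_distrib_left A_def cong: sum.cong)
  also have "(\<Sum>n=1..N. w n * (q (n + 1) - 2 * q n + q (n - 1))) = - w 1 * (q 1 - q 0) - S"
    using rest summation_by_parts [of w q N] by (simp add: S_def w_def)
  also have "(\<Sum>n=1..N. w n * (w (n + 1) - 2 * w n + w (n - 1))) = - w 1 * (w 1 - w 0) - D"
    using rest summation_by_parts [of w w N] by (simp add: D_def w_def power2_eq_square)
  finally have "energy N \<Delta>t c m2 V u k - energy N \<Delta>t c m2 V u (k - 1)
      = c ^ 2 / 2 * (- w 1 * (q 1 - q 0) - S) + \<beta> / (4 * \<Delta>t) * (- w 1 * (w 1 - w 0) - D)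
        - 1 / (4 * \<Delta>t) * A + c ^ 2 / 2 * (S + (w 1 - w 0) * (q 1 - q 0))"
    unfolding energy_difference [OF \<open>1 \<le> k\<close>] w_def [symmetric] q_def [symmetric] S_def [symmetric]
    by (simp add: q_def)
  \<comment> \<open>The bulk sums \<open>S\<close> cancel. What is left of the coupling is the work at \<open>n = 0\<close>, and the
    boundary term of the dissipation splits as \<open>w 1 = (w 1 - w 0) + w 0\<close>, so that the edge from
    \<open>0\<close> to \<open>1\<close> joins the sum of squares.\<close>
  also have "\<dots> = c ^ 2 / 2 * (w 0 * (q 0 - q 1))
        - 1 / (4 * \<Delta>t) * A - \<beta> / (4 * \<Delta>t) * (D + (w 1 - w 0) ^ 2 + (w 1 - w 0) * w 0)"
    by (simp add: algebra_simps power2_eq_square)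
  finally have increment: "energy N \<Delta>t c m2 V u k - energy N \<Delta>t c m2 V u (k - 1) = \<dots>" .
  have balance: "(energy N \<Delta>t c m2 V u k - energy N \<Delta>t c m2 V u (k - 1)) / \<Delta>t
      = c ^ 2 * (q 0 - q 1) * (w 0 / (2 * \<Delta>t)) - A / (2 * \<Delta>t) ^ 2
        - \<beta> * ((D + (w 1 - w 0) ^ 2) / (2 * \<Delta>t) ^ 2
               + (w 1 - w 0) / (2 * \<Delta>t) * (w 0 / (2 * \<Delta>t)))"
    unfolding increment using \<open>\<Delta>t \<noteq> 0\<close> by (simp add: field_simps power2_eq_square)
  have "(\<Sum>n=1..N + 1. (w n - w (n - 1)) ^ 2) = D + (w 1 - w 0) ^ 2"
    unfolding D_def by (induction N) (simp_all add: algebra_simps)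
  then have "(\<Sum>n=1..N + 1. ((w n - w (n - 1)) / (2 * \<Delta>t)) ^ 2)
      = (D + (w 1 - w 0) ^ 2) / (2 * \<Delta>t) ^ 2"
    by (metis (no_types, lifting) power_divide sum.cong sum_divide_distrib)
  moreover have "(\<Sum>n=1..N. \<alpha> n * (w n / (2 * \<Delta>t)) ^ 2) = A / (2 * \<Delta>t) ^ 2"
    by (simp add: A_def power_divide sum_divide_distrib)
  ultimately show ?thesis
    using balance by (simp only: w_def q_def)
qed

lemma infsum_eq_sum_of_finite_support:
  fixes f :: "nat \<Rightarrow> real"
  assumes "\<And>n. K < n \<Longrightarrow> f n = 0"
  shows "(\<Sum>\<^sub>\<infinity>n\<in>{1..}. f n) = (\<Sum>n=1..K. f n)"
proof -
  have "(\<Sum>\<^sub>\<infinity>n\<in>{1..}. f n) = (\<Sum>\<^sub>\<infinity>n\<in>{1..K}. f n)"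
    by (rule infsum_cong_neutral) (auto intro: assms)
  then show ?thesis
    by simp
qed

theorem proposition3:
  fixes N N\<^sub>0 M k :: nat
    and T \<Delta>t c \<beta> \<gamma> \<kappa> \<sigma> m2 :: real
    and \<alpha> :: "nat \<Rightarrow> real"
    and V \<psi> :: "real \<Rightarrow> real"
    and \<phi> \<phi>' :: "nat \<Rightarrow> real"
    and u :: grid
  assumes "\<Delta>t > 0" and "T = real M * \<Delta>t"
    and "\<beta> \<ge> 0" and "\<gamma> \<ge> 0"
    and "\<kappa> \<ge> 0" and "\<sigma> > 0" and "N\<^sub>0 < N"
    and "\<alpha> = total_damping \<gamma> \<kappa> \<sigma> N\<^sub>0 N"
    and "V = sine_gordon_potential \<or> V = klein_gordon_potential \<and> m2 = 0"
    and scheme: "\<And>n k. 1 \<le> n \<Longrightarrow> n \<le> N \<Longrightarrow> 1 \<le> k \<Longrightarrow> k \<le> M - 1 \<Longrightarrow>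
                   scheme_lhs \<Delta>t c \<beta> \<alpha> m2 V u n k = 0"
    and "\<And>n. 1 \<le> n \<Longrightarrow> n \<le> N \<Longrightarrow> u n 0 = \<phi> n"
    and "\<And>n. 1 \<le> n \<Longrightarrow> n \<le> N \<Longrightarrow> u n 1 = \<phi> n + \<Delta>t * \<phi>' n"
    and "\<And>k. k \<le> M \<Longrightarrow> u 0 k = \<psi> (real k * \<Delta>t)"
    and "\<And>n k. N + 1 \<le> n \<Longrightarrow> k \<le> M \<Longrightarrow> u n k = 0"
    and "1 \<le> k" and "k \<le> M - 1"
  shows "(energy N \<Delta>t c m2 V u k - energy N \<Delta>t c m2 V u (k - 1)) / \<Delta>t =
           c ^ 2 * (u 0 k - u 1 k) * (delta_t u 0 k / (2 * \<Delta>t))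
           - (\<Sum>\<^sub>\<infinity>n\<in>{1..}. \<alpha> n * (delta_t u n k / (2 * \<Delta>t)) ^ 2)
           - \<beta> * ((\<Sum>\<^sub>\<infinity>n\<in>{1..}. ((delta_t u n k - delta_t u (n - 1) k) / (2 * \<Delta>t)) ^ 2)
                  + (delta_t u 1 k - delta_t u 0 k) / (2 * \<Delta>t) * (delta_t u 0 k / (2 * \<Delta>t)))"
proof -
  have rest: "delta_t u n k = 0" if "N + 1 \<le> n" for n
    using assms(14) [OF that] \<open>1 \<le> k\<close> \<open>k \<le> M - 1\<close> by (simp add: delta_t_def)
  have external: "(\<Sum>\<^sub>\<infinity>n\<in>{1..}. \<alpha> n * (delta_t u n k / (2 * \<Delta>t)) ^ 2)
      = (\<Sum>n=1..N. \<alpha> n * (delta_t u n k / (2 * \<Delta>t)) ^ 2)"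
    by (rule infsum_eq_sum_of_finite_support) (simp add: rest)
  have internal: "(\<Sum>\<^sub>\<infinity>n\<in>{1..}. ((delta_t u n k - delta_t u (n - 1) k) / (2 * \<Delta>t)) ^ 2)
      = (\<Sum>n=1..N + 1. ((delta_t u n k - delta_t u (n - 1) k) / (2 * \<Delta>t)) ^ 2)"
    by (rule infsum_eq_sum_of_finite_support) (simp add: rest)
  show ?thesis
    unfolding external internal
  proof (rule energy_balance_finite)
    show "scheme_lhs \<Delta>t c \<beta> \<alpha> m2 V u n k = 0" if "1 \<le> n" "n \<le> N" for n
      using scheme that \<open>1 \<le> k\<close> \<open>k \<le> M - 1\<close> by blast
  qed (use \<open>\<Delta>t > 0\<close> \<open>1 \<le> k\<close> rest in simp_all)
qed

end
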